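(* The following families of constraints are valid inequalities for (SL-MCFLP), i.e. they are satisfied by every feasible solution $(x,y,u)$ of (SL-MCFLP) in which clients are served according to their preferences (in the sense defined in the context): i) For all $i,i'\in I$ and $s\in S_I(i)$ such that $J(i,s)\cap J(i',s)\ne\emptyset$ and client $i'$ also demands product $m(s)$ (i.e. $m(s)\in M_I(i')$): $$y_{is}\le \sum_{s'\in S_I(i')\cap S_M(m(s)):\ w_{i's'}\ge w_{i's}} y_{i's'}+\sum_{j\in J(i,s)\setminus J(i',s)} x_{jm(s)}.$$ ii) For all $i\in I$, $s\in S_I(i)$, $j\in J(i,s)$: $$x_{jm(s)}+\sum_{s'\in S_I(i)\cap S_M(m(s)):\ w_{is}>w_{is'}} y_{is'}\le 1.$$
   Context: Data. $I$ (clients), $J$ (potential second-level facilities), $M$ (products), $S$ (first-level facilities) are finite sets. Each $s\in S$ offers one product $m(s)\in M$. $M_I(i)\subseteq M$ is the set of products demanded by client $i$. $d_{sj}$ and $d_{ji}$ are distances between $s\in S$ and $j\in J$, and between $j\in J$ and $i\in I$; $R_m, r_m$ are covering radii for each $m\in M$. For $j\in J$, $b_j$ is a nonnegative integer (maximum number of different products $j$ can offer), and $T(j)=\{0,1,\dots,b_j\}$. $w_{is}$ is the (real) satisfaction of client $i$ when served product $m(s)$ from $s$; $c_{jt}$ is the cost of offering $t\in T(j)$ different products at $j$ (nondecreasing in $t$); $B$ is the budget. Derived sets. - $J(i,s)=\{j\in J: d_{ji}\le r_{m(s)},\ d_{sj}\le R_{m(s)}\}$. - $S_M(m)=\{s\in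 S: m(s)=m\}$. - $M_J(j)=\{m\in M:\exists s\in S \text{ with } m(s)=m,\ d_{sj}\le R_m\}$. - $S_I(i)=\{s\in S: m(s)\in M_I(i),\ J(i,s)\ne\emptyset\}$. Formulation (SL-MCFLP). Variables $y_{is}$ ($i\in I, s\in S_I(i)$), $x_{jm}$ ($j\in J, m\in M_J(j)$), $u_{jt}$ ($j\in J,t\in T(j)$): $$\max \sum_{i\in I}\sum_{s\in S_I(i)} w_{is}y_{is}$$ subject to - $\sum_{j\in J(i,s)}x_{jm(s)}\ge y_{is}$ for $i\in I, s\in S_I(i)$; - $\sum_{s\in S_I(i)\cap S_M(m)}y_{is}\le 1$ for $i\in I, m\in M_I(i)$; - $\sum_{m\in M_J(j)}x_{jm}=\sum_{t\in T(j)}t\,u_{jt}$ for $j\in J$; - $\sum_{t\in T(j)}u_{jt}=1$ for $j\in J$; - $\sum_{j\in J}\sum_{t\in T(j)}c_{jt}u_{jt}\le B$; - $y_{is}\in\{0,1\}$, $x_{jm}\in\{0,1\}$, $u_{jt}\in\{0,1\}$ for all indices. Preference assumption of the model: a client who can be served a demanded product is served it from the most preferred available source. Precisely, in a feasible solution $(x,y,u)$, for $i\in I$ and $m\in M_I(i)$ call $s\in S_I(i)\cap S_M(m)$ available to $i$ if $\sum_{j\in J(i,s)}x_{jm}\ge 1$. Clients are served according to their preferences if, for every $i\in I$ and $m\in M_I(i)$ for which some source is available, there is an available $s^*\in S_I(i)\cap S_M(m)$ with $w_{is^*}$ maximal among all sources in $S_I(i)\cap S_M(m)$ available to $i$, such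 that $y_{is^*}=1$. *)

theory Defs
  imports Complex_Main
begin

record ('i, 'j, 'm, 's) mcflp =
  clients :: "'i set"
  facilities :: "'j set"
  products :: "'m set"
  sources :: "'s set"
  prod_of :: "'s \<Rightarrow> 'm"
  demand :: "'i \<Rightarrow> 'm set"
  dist_sj :: "'s \<Rightarrow> 'j \<Rightarrow> real"
  dist_ji :: "'j \<Rightarrow> 'i \<Rightarrow> real"
  rad_sj :: "'m \<Rightarrow> real"  \<comment> \<open>the radius written capital R\<close>
  rad_ji :: "'m \<Rightarrow> real"  \<comment> \<open>the radius written small r\<close>
  capacity :: "'j \<Rightarrow> nat"
  satisf :: "'i \<Rightarrow> 's \<Rightarrow> real"
  cost :: "'j \<Rightarrow> nat \<Rightarrow> real"
  budget :: real

definition levels :: "('i, 'j, 'm, 's) mcflp \<Rightarrow> 'j \<Rightarrow> nat set" where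
  "levels P j = {0..capacity P j}"

definition mcflp_data :: "('i, 'j, 'm, 's) mcflp \<Rightarrow> bool" where
  "mcflp_data P \<longleftrightarrow>
     finite (clients P) \<and> finite (facilities P) \<and> finite (products P) \<and> finite (sources P) \<and>
     (\<forall>s\<in>sources P. prod_of P s \<in> products P) \<and>
     (\<forall>i\<in>clients P. demand P i \<subseteq> products P) \<and>
     (\<forall>s\<in>sources P. \<forall>j\<in>facilities P. 0 \<le> dist_sj P s j) \<and>
     (\<forall>j\<in>facilities P. \<forall>i\<in>clients P. 0 \<le> dist_ji P j i) \<and>
     (\<forall>j\<in>facilities P. mono_on (levels P j) (cost P j))"

definition J_cov :: "('i, 'j, 'm, 's) mcflp \<Rightarrow> 'i \<Rightarrow> 's \<Rightarrow> 'j set" where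
  "J_cov P i s = {j \<in> facilities P. dist_ji P j i \<le> rad_ji P (prod_of P s) \<and>
                                    dist_sj P s j \<le> rad_sj P (prod_of P s)}"

definition S_M :: "('i, 'j, 'm, 's) mcflp \<Rightarrow> 'm \<Rightarrow> 's set" where
  "S_M P m = {s \<in> sources P. prod_of P s = m}"

definition M_J :: "('i, 'j, 'm, 's) mcflp \<Rightarrow> 'j \<Rightarrow> 'm set" where
  "M_J P j = {m \<in> products P. \<exists>s\<in>sources P. prod_of P s = m \<and> dist_sj P s j \<le> rad_sj P m}"

definition S_I :: "('i, 'j, 'm, 's) mcflp \<Rightarrow> 'i \<Rightarrow> 's set" where
  "S_I P i = {s \<in> sources P. prod_of P s \<in> demand P i \<and> J_cov P i s \<noteq> {}}"

text \<open>Decision variables are total functions; only their values on the index sets of the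
  formulation are constrained or used.\<close>

definition objective :: "('i, 'j, 'm, 's) mcflp \<Rightarrow> ('i \<Rightarrow> 's \<Rightarrow> real) \<Rightarrow> real" where
  "objective P y = (\<Sum>i\<in>clients P. \<Sum>s\<in>S_I P i. satisf P i s * y i s)"

definition feasible ::
  "('i, 'j, 'm, 's) mcflp \<Rightarrow> ('j \<Rightarrow> 'm \<Rightarrow> real) \<Rightarrow> ('i \<Rightarrow> 's \<Rightarrow> real) \<Rightarrow> ('j \<Rightarrow> nat \<Rightarrow> real) \<Rightarrow> bool" where
  "feasible P x y u \<longleftrightarrow>
     (\<forall>i\<in>clients P. \<forall>s\<in>S_I P i. (\<Sum>j\<in>J_cov P i s. x j (prod_of P s)) \<ge> y i s) \<and>
     (\<forall>i\<in>clients P. \<forall>m\<in>demand P i. (\<Sum>s\<in>S_I P i \<inter> S_M P m. y i s) \<le> 1) \<and>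
     (\<forall>j\<in>facilities P. (\<Sum>m\<in>M_J P j. x j m) = (\<Sum>t\<in>levels P j. real t * u j t)) \<and>
     (\<forall>j\<in>facilities P. (\<Sum>t\<in>levels P j. u j t) = 1) \<and>
     (\<Sum>j\<in>facilities P. \<Sum>t\<in>levels P j. cost P j t * u j t) \<le> budget P \<and>
     (\<forall>i\<in>clients P. \<forall>s\<in>S_I P i. y i s \<in> {0, 1}) \<and>
     (\<forall>j\<in>facilities P. \<forall>m\<in>M_J P j. x j m \<in> {0, 1}) \<and>
     (\<forall>j\<in>facilities P. \<forall>t\<in>levels P j. u j t \<in> {0, 1})"

definition available ::
  "('i, 'j, 'm, 's) mcflp \<Rightarrow> ('j \<Rightarrow> 'm \<Rightarrow> real) \<Rightarrow> 'i \<Rightarrow> 'm \<Rightarrow> 's set" where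
  "available P x i m = {s \<in> S_I P i \<inter> S_M P m. (\<Sum>j\<in>J_cov P i s. x j m) \<ge> 1}"

definition served_by_preference ::
  "('i, 'j, 'm, 's) mcflp \<Rightarrow> ('j \<Rightarrow> 'm \<Rightarrow> real) \<Rightarrow> ('i \<Rightarrow> 's \<Rightarrow> real) \<Rightarrow> bool" where
  "served_by_preference P x y \<longleftrightarrow>
     (\<forall>i\<in>clients P. \<forall>m\<in>demand P i. available P x i m \<noteq> {} \<longrightarrow>
        (\<exists>s\<in>available P x i m.
           (\<forall>s'\<in>available P x i m. satisf P i s' \<le> satisf P i s) \<and> y i s = 1))"

end

theory Submission
  imports Defs
begin

text \<open>Both families rest on one observation: an open facility \<open>j \<in> J(i,s)\<close> makes \<open>s\<close> available
  to \<open>i\<close>, so by preference \<open>i\<close> is served from a source at least as good as \<open>s\<close>. In (i), if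
  \<open>y\<^sub>i\<^sub>s = 1\<close> then some open \<open>j\<close> covers \<open>i\<close>, and either \<open>j \<notin> J(i',s)\<close> or the observation
  applies to \<open>i'\<close>. In (ii), such a source uses up the single unit that \<open>i\<close> may receive of the
  product, so nothing is left for the less preferred sources.\<close>

lemma finite_J_cov:
  assumes "mcflp_data P"
  shows "finite (J_cov P i s)"
  using assms unfolding mcflp_data_def J_cov_def by auto

lemma finite_S_I:
  assumes "mcflp_data P"
  shows "finite (S_I P i)"
  using assms unfolding mcflp_data_def S_I_def by auto

text \<open>\<open>feasible\<close> makes \<open>x\<close> binary only on \<open>M_J P j\<close>;
  the \<open>rad_sj\<close> condition inside \<open>J_cov\<close> puts the product of
  \<open>s\<close> there. That condition does not involve the client, so \<open>i'\<close> is
  arbitrary.\<close>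

lemma x_binary:
  assumes "mcflp_data P" "feasible P x y u" "s \<in> S_I P i" "j \<in> J_cov P i' s"
  shows "x j (prod_of P s) \<in> {0, 1}"
proof -
  have "s \<in> sources P" using assms(3) by (simp add: S_I_def)
  then have "prod_of P s \<in> M_J P j" "j \<in> facilities P"
    using assms(1,4) by (auto simp: M_J_def J_cov_def mcflp_data_def)
  then show ?thesis using assms(2) by (simp add: feasible_def)
qed

lemma y_binary:
  assumes "feasible P x y u" "i \<in> clients P" "s \<in> S_I P i"
  shows "y i s \<in> {0, 1}"
  using assms by (simp add: feasible_def)

lemma y_nonneg:
  assumes "feasible P x y u" "i \<in> clients P" "s \<in> S_I P i"
  shows "0 \<le> y i s"
  using y_binary[OF assms] by auto

text \<open>The facility \<open>j\<close> witnesses that \<open>J_cov P i' s\<close> is nonempty,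
  which allows the preferences of \<open>i'\<close> to be applied to a source of
  \<open>i\<close>.\<close>

lemma S_I_cover:
  assumes "s \<in> S_I P i" "prod_of P s \<in> demand P i'" "j \<in> J_cov P i' s"
  shows "s \<in> S_I P i'"
  using assms by (auto simp: S_I_def)

lemma served_at_least_as_preferred:
  assumes P: "mcflp_data P" and feas: "feasible P x y u" and pref: "served_by_preference P x y"
    and i: "i \<in> clients P" and s: "s \<in> S_I P i"
    and j: "j \<in> J_cov P i s" and x: "x j (prod_of P s) = 1"
  obtains s' where "s' \<in> S_I P i \<inter> S_M P (prod_of P s)" "satisf P i s \<le> satisf P i s'" "y i s' = 1"
proof -
  \<comment> \<open>All terms are nonnegative, so the open facility \<open>j\<close> alone lifts the
    sum to the threshold 1 in \<open>available\<close>.\<close>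
  have "x j (prod_of P s) \<le> (\<Sum>j\<in>J_cov P i s. x j (prod_of P s))"
    using x_binary[OF P feas s] by (intro member_le_sum finite_J_cov P j) force
  then have "s \<in> available P x i (prod_of P s)"
    using s x by (simp add: available_def S_I_def S_M_def)
  moreover have "prod_of P s \<in> demand P i" using s by (simp add: S_I_def)
  ultimately obtain s' where s': "s' \<in> available P x i (prod_of P s)"
    "satisf P i s \<le> satisf P i s'" "y i s' = 1"
    using pref i unfolding served_by_preference_def by blast
  then show thesis using that by (auto simp: available_def)
qed

text \<open>The linking constraint makes the sum of \<open>x\<close> over \<open>J_cov P i s\<close>
  nonzero, so some term is nonzero and, being binary, equals 1.\<close>

lemma serving_facility:
  assumes P: "mcflp_data P" and feas: "feasible P x y u"
    and i: "i \<in> clients P" and s: "s \<in> S_I P i" and y: "y i s = 1"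
  obtains j where "j \<in> J_cov P i s" "x j (prod_of P s) = 1"
proof -
  have "y i s \<le> (\<Sum>j\<in>J_cov P i s. x j (prod_of P s))"
    using feas i s by (simp add: feasible_def)
  with y have "(\<Sum>j\<in>J_cov P i s. x j (prod_of P s)) \<noteq> 0" by simp
  then obtain j where "j \<in> J_cov P i s" "x j (prod_of P s) \<noteq> 0"
    by (rule sum.not_neutral_contains_not_neutral)
  then show thesis using x_binary[OF P feas s] that by blast
qed

lemma coverage_inequality:
  assumes P: "mcflp_data P" and feas: "feasible P x y u" and pref: "served_by_preference P x y"
    and i: "i \<in> clients P" and i': "i' \<in> clients P" and s: "s \<in> S_I P i"
    and dem: "prod_of P s \<in> demand P i'"
  shows "y i s \<le> (\<Sum>s'\<in>{s' \<in> S_I P i' \<inter> S_M P (prod_of P s). satisf P i' s' \<ge> satisf P i' s}. y i' s')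
           + (\<Sum>j\<in>J_cov P i s - J_cov P i' s. x j (prod_of P s))"
    (is "_ \<le> (\<Sum>s'\<in>?A. _) + (\<Sum>j\<in>?D. _)")
proof -
  have finA: "finite ?A" using finite_S_I[OF P] by auto
  have finD: "finite ?D" using finite_J_cov[OF P] by auto
  have y0: "0 \<le> y i' s'" if "s' \<in> ?A" for s' using y_nonneg[OF feas i'] that by auto
  have x0: "0 \<le> x j (prod_of P s)" if "j \<in> ?D" for j
    using x_binary[OF P feas s, of j i] that by auto
  have sumA: "0 \<le> (\<Sum>s'\<in>?A. y i' s')" by (intro sum_nonneg y0)
  have sumD: "0 \<le> (\<Sum>j\<in>?D. x j (prod_of P s))" by (intro sum_nonneg x0)
  \<comment> \<open>Both sums are nonnegative, so only \<open>y i s = 1\<close> matters; then one of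
    them must contain a term equal to 1.\<close>
  show ?thesis
  proof (cases "y i s = 1")
    case True
    with serving_facility[OF P feas i s]
    obtain j where j: "j \<in> J_cov P i s" and xj: "x j (prod_of P s) = 1" by blast
    show ?thesis
    proof (cases "j \<in> J_cov P i' s")
      case cov: True
      obtain s' where s': "s' \<in> S_I P i' \<inter> S_M P (prod_of P s)"
          "satisf P i' s \<le> satisf P i' s'" "y i' s' = 1"
        by (rule served_at_least_as_preferred[OF P feas pref i' S_I_cover[OF s dem cov] cov xj])
      then have "y i' s' \<le> (\<Sum>s'\<in>?A. y i' s')"
        by (intro member_le_sum finA y0) auto
      then show ?thesis using \<open>y i s = 1\<close> s' sumD by simp
    next
      case False
      then have "x j (prod_of P s) \<le> (\<Sum>j\<in>?D. x j (prod_of P s))"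
        using j by (intro member_le_sum[where f = "\<lambda>j. x j (prod_of P s)"] finD x0) auto
      then show ?thesis using \<open>y i s = 1\<close> xj sumA by simp
    qed
  next
    case False
    then have "y i s = 0" using y_binary[OF feas i s] by auto
    then show ?thesis using sumA sumD by simp
  qed
qed

lemma preference_inequality:
  assumes P: "mcflp_data P" and feas: "feasible P x y u" and pref: "served_by_preference P x y"
    and i: "i \<in> clients P" and s: "s \<in> S_I P i" and j: "j \<in> J_cov P i s"
  shows "x j (prod_of P s)
           + (\<Sum>s'\<in>{s' \<in> S_I P i \<inter> S_M P (prod_of P s). satisf P i s > satisf P i s'}. y i s') \<le> 1"
    (is "_ + (\<Sum>s'\<in>?L. _) \<le> 1")
proof -
  let ?S = "S_I P i \<inter> S_M P (prod_of P s)"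
  have fin: "finite ?S" using finite_S_I[OF P] by auto
  have y0: "0 \<le> y i s'" if "s' \<in> ?S" for s' using y_nonneg[OF feas i] that by auto
  \<comment> \<open>Membership of \<open>s\<close> in \<open>S_I P i\<close> makes its product
    demanded, so the single-service constraint applies to it.\<close>
  have le1: "(\<Sum>s'\<in>?S. y i s') \<le> 1"
    using feas i s by (simp add: feasible_def S_I_def)
  show ?thesis
  proof (cases "x j (prod_of P s) = 1")
    case True
    obtain s' where s': "s' \<in> ?S" "satisf P i s \<le> satisf P i s'" "y i s' = 1"
      by (rule served_at_least_as_preferred[OF P feas pref i s j True])
    \<comment> \<open>\<open>s'\<close> lies outside \<open>?L\<close> because it is at least as
      good as \<open>s\<close>; its unit therefore adds to the sum over \<open>?L\<close> within the
      same bound 1.\<close>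
    have "s' \<notin> ?L" "finite ?L" using s' finite_S_I[OF P] by auto
    then have "y i s' + (\<Sum>s'\<in>?L. y i s') = (\<Sum>s'\<in>insert s' ?L. y i s')" by simp
    also have "\<dots> \<le> (\<Sum>s'\<in>?S. y i s')"
      using s' by (intro sum_mono2 fin y0) auto
    finally show ?thesis using le1 True s' by simp
  next
    case False
    then have "x j (prod_of P s) = 0" using x_binary[OF P feas s j] by auto
    moreover have "(\<Sum>s'\<in>?L. y i s') \<le> (\<Sum>s'\<in>?S. y i s')"
      by (intro sum_mono2 fin y0) auto
    ultimately show ?thesis using le1 by simp
  qed
qed

theorem proposition3p1:
  fixes P :: "('i, 'j, 'm, 's) mcflp"
    and x :: "'j \<Rightarrow> 'm \<Rightarrow> real"
    and y :: "'i \<Rightarrow> 's \<Rightarrow> real"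
    and u :: "'j \<Rightarrow> nat \<Rightarrow> real"
  assumes "mcflp_data P"
    and "feasible P x y u"
    and "served_by_preference P x y"
  shows "(\<forall>i\<in>clients P. \<forall>i'\<in>clients P. \<forall>s\<in>S_I P i.
            J_cov P i s \<inter> J_cov P i' s \<noteq> {} \<longrightarrow> prod_of P s \<in> demand P i' \<longrightarrow>
            y i s \<le> (\<Sum>s'\<in>{s' \<in> S_I P i' \<inter> S_M P (prod_of P s). satisf P i' s' \<ge> satisf P i' s}. y i' s')
                    + (\<Sum>j\<in>J_cov P i s - J_cov P i' s. x j (prod_of P s)))
       \<and> (\<forall>i\<in>clients P. \<forall>s\<in>S_I P i. \<forall>j\<in>J_cov P i s.
            x j (prod_of P s)
              + (\<Sum>s'\<in>{s' \<in> S_I P i \<inter> S_M P (prod_of P s). satisf P i s > satisf P i s'}. y i s') \<le> 1)"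
  using coverage_inequality[OF assms] preference_inequality[OF assms] by blast

end
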